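(* Suppose that $\clubsuit_{\mathrm{AD}}(\{\omega_1\},\omega,1)$ holds. Then there exists a collectionwise normal, non-Lindel\"of $O$-space.
   Context: All topological spaces are assumed $T_1$ and Hausdorff. An $O$-space is an uncountable regular topological space all of whose uncountable open sets are co-countable. A sequence $\langle K_i\mid i<\theta\rangle$ of subsets of a space $X$ is discrete iff every point of $X$ has an open neighborhood meeting at most one $K_i$; $X$ is collectionwise normal iff for every discrete sequence $\langle K_i\mid i<\theta\rangle$ of closed sets there are pairwise disjoint open sets $U_i\supseteq K_i$ ($i<\theta$). $\mathrm{acc}(\omega_1)$ is the set of countable nonzero limit ordinals. A sequence $\langle \mathcal A_\alpha\mid\alpha\in S\rangle$ is an AD-multi-ladder system iff (i) for every $\alpha\in S\cap\mathrm{acc}(\omega_1)$, $\mathcal A_\alpha$ is a nonempty family of pairwise disjoint cofinal subsets of $\alpha$, and (ii) for any two distinct $A,A'\in\bigcup_{\alpha\in S}\mathcal A_\alpha$, $\sup(A\cap A')<\sup(A)$. $\clubsuit_{\mathrm{AD}}(\{\omega_1\},\omega,1)$ asserts the existence of an AD-multi-ladder system $\langle\mathcal A_\alpha\mid\alpha<\omega_1\rangle$ such that $|\mathcal A_\alpha|=\omega$ for every $\alpha<\omega_1$, and for every uncountable $B\subseteq\omega_1$ the set $\{\alpha<\omega_1\mid \forall A\in\mathcal A_\alpha\ [\sup(A\cap B)=\alpha]\}$ is stationary. *)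

theory Defs
  imports
    "HOL-Analysis.Analysis"
    "HOL-Library.Equipollence"
    "HOL-Library.Extended"
    "HOL-Library.Countable_Set_Type"
begin

typedef omega1 = "Field (cardSuc natLeq)"
  using Field_cardSuc_not_empty[OF natLeq_Card_order] by auto

instantiation omega1 :: wellorder
begin

definition less_eq_omega1 :: "omega1 \<Rightarrow> omega1 \<Rightarrow> bool" where
  "\<alpha> \<le> \<beta> \<longleftrightarrow> (Rep_omega1 \<alpha>, Rep_omega1 \<beta>) \<in> cardSuc natLeq"

definition less_omega1 :: "omega1 \<Rightarrow> omega1 \<Rightarrow> bool" where
  "\<alpha> < \<beta> \<longleftrightarrow> \<alpha> \<le> \<beta> \<and> \<not> \<beta> \<le> (\<alpha>::omega1)"

instance
proof
  have wo: "Well_order (cardSuc natLeq)"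
    using cardSuc_Card_order[OF natLeq_Card_order] by (simp add: card_order_on_def)
  then have refl: "refl_on (Field (cardSuc natLeq)) (cardSuc natLeq)"
    and trans: "trans (cardSuc natLeq)" and antisym: "antisym (cardSuc natLeq)"
    and total: "total_on (Field (cardSuc natLeq)) (cardSuc natLeq)"
    and wf: "wf (cardSuc natLeq - Id)"
    by (auto simp: order_on_defs well_order_on_def)
  show "\<alpha> \<le> \<alpha>" for \<alpha> :: omega1
    unfolding less_eq_omega1_def using refl Rep_omega1 by (blast dest: refl_onD)
  show "\<alpha> \<le> \<gamma>" if "\<alpha> \<le> \<beta>" "\<beta> \<le> \<gamma>" for \<alpha> \<beta> \<gamma> :: omega1
    using that trans unfolding less_eq_omega1_def by (blast dest: transD)
  show anti: "\<alpha> = \<beta>" if "\<alpha> \<le> \<beta>" "\<beta> \<le> \<alpha>" for \<alpha> \<beta> :: omega1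
    using that antisym Rep_omega1_inject unfolding less_eq_omega1_def by (blast dest: antisymD)
  show "\<alpha> \<le> \<beta> \<or> \<beta> \<le> \<alpha>" for \<alpha> \<beta> :: omega1
    using total refl Rep_omega1[of \<alpha>] Rep_omega1[of \<beta>]
    unfolding less_eq_omega1_def total_on_def by (metis refl_onD)
  show "(\<alpha> < \<beta>) = (\<alpha> \<le> \<beta> \<and> \<not> \<beta> \<le> \<alpha>)" for \<alpha> \<beta> :: omega1
    by (rule less_omega1_def)
  have sub: "{(\<alpha>, \<beta>). \<alpha> < (\<beta>::omega1)} \<subseteq> inv_image (cardSuc natLeq - Id) Rep_omega1"
    unfolding less_omega1_def less_eq_omega1_def inv_image_def by auto
  have wfl: "wf {(\<alpha>, \<beta>). \<alpha> < (\<beta>::omega1)}"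
    using wf_subset[OF wf_inv_image[OF wf] sub] .
  show "P \<alpha>" if "\<And>\<alpha>. (\<And>\<beta>. \<beta> < \<alpha> \<Longrightarrow> P \<beta>) \<Longrightarrow> P \<alpha>" for P and \<alpha> :: omega1
    using wfl that by (induction \<alpha> rule: wf_induct_rule) auto
qed

end

lemma uncountable_UNIV_omega1:
  includes cardinal_syntax
  shows "uncountable (UNIV :: omega1 set)"
proof
  assume "countable (UNIV :: omega1 set)"
  then have "countable (Field (cardSuc natLeq))"
    by (metis countable_image type_definition.Rep_range[OF type_definition_omega1])
  then have "|Field (cardSuc natLeq)| \<le>o natLeq"
    by (simp add: countable_card_le_natLeq)
  then have "cardSuc natLeq \<le>o natLeq"
    using card_of_Field_ordIso[OF cardSuc_Card_order[OF natLeq_Card_order]]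
      ordIso_ordLeq_trans ordIso_symmetric by blast
  then show False
    using cardSuc_greater[OF natLeq_Card_order] not_ordLess_ordLeq by blast
qed

lemma countable_lessThan_omega1:
  includes cardinal_syntax
  shows "countable {..< \<alpha> :: omega1}"
proof -
  have co: "Card_order (cardSuc natLeq)"
    by (rule cardSuc_Card_order[OF natLeq_Card_order])
  have "|underS (cardSuc natLeq) (Rep_omega1 \<alpha>)| <o cardSuc natLeq"
    using card_of_underS[OF co Rep_omega1] .
  then have "countable (underS (cardSuc natLeq) (Rep_omega1 \<alpha>))"
    by (simp add: countable_card_le_natLeq cardSuc_ordLeq_ordLess[OF natLeq_Card_order card_of_Card_order])
  moreover have "Rep_omega1 ` {..<\<alpha>} \<subseteq> underS (cardSuc natLeq) (Rep_omega1 \<alpha>)"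
    by (auto simp: underS_def less_omega1_def less_eq_omega1_def)
  ultimately have "countable (Rep_omega1 ` {..<\<alpha>})"
    by (rule countable_subset[rotated])
  then show ?thesis
    by (rule countable_image_inj_on) (simp add: inj_on_def Rep_omega1_inject)
qed

definition acc_omega1 :: "omega1 set" where
  "acc_omega1 = {\<alpha>. (\<exists>\<beta>. \<beta> < \<alpha>) \<and> (\<forall>\<beta><\<alpha>. \<exists>\<gamma><\<alpha>. \<beta> < \<gamma>)}"

text \<open>The supremum of a set of countable ordinals is an ordinal \<open>\<le> \<omega>\<^sub>1\<close>; the value \<open>\<omega>\<^sub>1\<close>
  is represented by \<^const>\<open>Pinf\<close>. The supremum of the empty set is the least ordinal
  (the value \<^const>\<open>Minf\<close> is not used).\<close>

definition osup :: "omega1 set \<Rightarrow> omega1 extended" where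
  "osup A = (if bdd_above A then Fin (LEAST \<beta>. \<forall>\<alpha>\<in>A. \<alpha> \<le> \<beta>) else Pinf)"

definition cofinal_subset :: "omega1 set \<Rightarrow> omega1 \<Rightarrow> bool" where
  "cofinal_subset A \<alpha> \<longleftrightarrow> A \<subseteq> {..<\<alpha>} \<and> (\<forall>\<beta><\<alpha>. \<exists>\<gamma>\<in>A. \<beta> \<le> \<gamma>)"

definition club_omega1 :: "omega1 set \<Rightarrow> bool" where
  "club_omega1 C \<longleftrightarrow>
     (\<forall>\<beta>. \<exists>\<gamma>\<in>C. \<beta> < \<gamma>) \<and>
     (\<forall>\<alpha>\<in>acc_omega1. cofinal_subset (C \<inter> {..<\<alpha>}) \<alpha> \<longrightarrow> \<alpha> \<in> C)"

definition stationary_omega1 :: "omega1 set \<Rightarrow> bool" where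
  "stationary_omega1 S \<longleftrightarrow> (\<forall>C. club_omega1 C \<longrightarrow> S \<inter> C \<noteq> {})"

definition AD_multi_ladder_system :: "omega1 set \<Rightarrow> (omega1 \<Rightarrow> omega1 set set) \<Rightarrow> bool" where
  "AD_multi_ladder_system S \<A> \<longleftrightarrow>
     (\<forall>\<alpha> \<in> S \<inter> acc_omega1.
        \<A> \<alpha> \<noteq> {} \<and> pairwise disjnt (\<A> \<alpha>) \<and> (\<forall>A\<in>\<A> \<alpha>. cofinal_subset A \<alpha>)) \<and>
     (\<forall>A \<in> (\<Union>\<alpha>\<in>S. \<A> \<alpha>). \<forall>A' \<in> (\<Union>\<alpha>\<in>S. \<A> \<alpha>).
        A \<noteq> A' \<longrightarrow> osup (A \<inter> A') < osup A)"

text \<open>The principle \<open>\<clubsuit>\<^sub>A\<^sub>D({\<omega>\<^sub>1}, \<omega>, 1)\<close>.\<close>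

definition clubsuit_AD_omega1_omega_1 :: bool where
  "clubsuit_AD_omega1_omega_1 \<longleftrightarrow>
     (\<exists>\<A>. AD_multi_ladder_system UNIV \<A> \<and>
        (\<forall>\<alpha>. \<A> \<alpha> \<approx> (UNIV :: nat set)) \<and>
        (\<forall>B. uncountable B \<longrightarrow>
           stationary_omega1 {\<alpha>. \<forall>A\<in>\<A> \<alpha>. osup (A \<inter> B) = Fin \<alpha>}))"

text \<open>All spaces are \<open>T\<^sub>1\<close> and Hausdorff by convention; this is made explicit here.\<close>

definition O_space :: "'a topology \<Rightarrow> bool" where
  "O_space X \<longleftrightarrow>
     t1_space X \<and> Hausdorff_space X \<and>
     uncountable (topspace X) \<and> regular_space X \<and>
     (\<forall>U. openin X U \<and> uncountable U \<longrightarrow> countable (topspace X - U))"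

definition discrete_family :: "'a topology \<Rightarrow> 'i set \<Rightarrow> ('i \<Rightarrow> 'a set) \<Rightarrow> bool" where
  "discrete_family X I K \<longleftrightarrow>
     (\<forall>x \<in> topspace X. \<exists>N. openin X N \<and> x \<in> N \<and>
        (\<forall>i\<in>I. \<forall>j\<in>I. N \<inter> K i \<noteq> {} \<and> N \<inter> K j \<noteq> {} \<longrightarrow> i = j))"

text \<open>A definition cannot quantify over the type of indices. The nonempty members of a discrete
  family are pairwise disjoint, hence at most as many as there are points, so it suffices to index
  by elements of the type of points; see \<open>collectionwise_normal_any_index\<close>.\<close>

definition collectionwise_normal :: "'a topology \<Rightarrow> bool" where
  "collectionwise_normal X \<longleftrightarrow>
     (\<forall>(I :: 'a set) K. (\<forall>i\<in>I. closedin X (K i)) \<and> discrete_family X I K \<longrightarrow>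
        (\<exists>U. (\<forall>i\<in>I. openin X (U i) \<and> K i \<subseteq> U i) \<and> disjoint_family_on U I))"

lemma collectionwise_normal_any_index:
  fixes X :: "'a topology" and I :: "'i set" and K :: "'i \<Rightarrow> 'a set"
  assumes X: "collectionwise_normal X"
    and closed: "\<And>i. i \<in> I \<Longrightarrow> closedin X (K i)"
    and discrete: "discrete_family X I K"
  shows "\<exists>U. (\<forall>i\<in>I. openin X (U i) \<and> K i \<subseteq> U i) \<and> disjoint_family_on U I"
proof -
  define J where "J = {i\<in>I. K i \<noteq> {}}"
  define p where "p = (\<lambda>i. SOME x. x \<in> K i)"
  have p: "p i \<in> K i" if "i \<in> J" for i
    using that unfolding J_def p_def by (auto intro: someI_ex)
  have J: "i \<in> I" if "i \<in> J" for i
    using that by (simp add: J_def)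
  have inj: "inj_on p J"
  proof (rule inj_onI)
    fix i j assume ij: "i \<in> J" "j \<in> J" "p i = p j"
    have "p i \<in> topspace X"
      using p[OF ij(1)] closedin_subset[OF closed[OF J[OF ij(1)]]] by blast
    then obtain N where N: "p i \<in> N"
        "\<And>i j. i \<in> I \<Longrightarrow> j \<in> I \<Longrightarrow> N \<inter> K i \<noteq> {} \<Longrightarrow> N \<inter> K j \<noteq> {} \<Longrightarrow> i = j"
      using discrete unfolding discrete_family_def by meson
    have "N \<inter> K i \<noteq> {}" "N \<inter> K j \<noteq> {}"
      using N(1) p[OF ij(1)] p[OF ij(2)] ij(3) by auto
    then show "i = j"
      using N(2) J ij by blast
  qed
  define q where "q = the_inv_into J p"
  have q: "q (p i) = i" if "i \<in> J" for i
    unfolding q_def using the_inv_into_f_f[OF inj that] .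
  have "\<forall>a\<in>p ` J. closedin X (K (q a))"
    using q J closed by auto
  moreover have "discrete_family X (p ` J) (\<lambda>a. K (q a))"
    unfolding discrete_family_def
  proof
    fix x assume "x \<in> topspace X"
    then obtain N where N: "openin X N" "x \<in> N"
        "\<And>i j. i \<in> I \<Longrightarrow> j \<in> I \<Longrightarrow> N \<inter> K i \<noteq> {} \<Longrightarrow> N \<inter> K j \<noteq> {} \<Longrightarrow> i = j"
      using discrete unfolding discrete_family_def by meson
    have "a = b" if "a \<in> p ` J" "b \<in> p ` J" "N \<inter> K (q a) \<noteq> {}" "N \<inter> K (q b) \<noteq> {}" for a b
      using that N(3) q J by (metis imageE)
    with N(1,2) show "\<exists>N. openin X N \<and> x \<in> N \<and> (\<forall>a\<in>p ` J. \<forall>b\<in>p ` J.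
        N \<inter> K (q a) \<noteq> {} \<and> N \<inter> K (q b) \<noteq> {} \<longrightarrow> a = b)"
      by blast
  qed
  ultimately obtain U where U: "\<And>a. a \<in> p ` J \<Longrightarrow> openin X (U a) \<and> K (q a) \<subseteq> U a"
      "disjoint_family_on U (p ` J)"
    using X[unfolded collectionwise_normal_def, rule_format, of "p ` J" "\<lambda>a. K (q a)"] by blast
  define V where "V = (\<lambda>i. if i \<in> J then U (p i) else {})"
  have "openin X (V i) \<and> K i \<subseteq> V i" if "i \<in> I" for i
  proof (cases "i \<in> J")
    case True
    then show ?thesis
      using U(1)[of "p i"] q[OF True] by (simp add: V_def)
  next
    case False
    then show ?thesis
      using that by (simp add: V_def J_def)
  qed
  moreover have "disjoint_family_on V I"
    unfolding disjoint_family_on_def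
  proof (intro ballI impI)
    fix i j assume "i \<in> I" "j \<in> I" "i \<noteq> j"
    then show "V i \<inter> V j = {}"
      using U(2) inj unfolding V_def disjoint_family_on_def by (auto dest: inj_onD)
  qed
  ultimately show ?thesis
    by blast
qed

end

theory Submission
  imports Defs
begin

text \<open>Write \<open>\<lambda>(x)\<close> for the largest limit ordinal below or equal to \<open>x\<close>. Only countably
  many points have \<open>\<lambda>(x) = \<alpha>\<close>, so they can be assigned distinct ladders
  \<open>L\<^sub>x \<in> \<A>\<^sub>\<alpha>\<close>; a set \<open>U\<close> of countable ordinals is declared open when it contains a tail of
  \<open>L\<^sub>x\<close> for every \<open>x \<in> U\<close>. Initial segments are open, so the space is not Lindelof.

  If \<open>F\<close> is closed and uncountable, guessing yields a limit \<open>\<alpha>\<close> all of whose ladders meet \<open>F\<close>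
  cofinally, so \<open>F\<close> contains every \<open>x\<close> with \<open>\<lambda>(x) = \<alpha>\<close>; by induction it contains all
  \<open>x \<ge> \<alpha>\<close>. Hence closed sets are countable or co-countable, and in a discrete family of closed sets
  all members are contained in one countable ordinal \<open>\<delta>\<close>, except perhaps one that contains
  everything above \<open>\<delta>\<close>.

  Below a countable ordinal, almost disjointness allows one to shrink the ladders to pairwise
  disjoint tails. Then each point lies in at most one tail, so the relation ``\<open>y\<close> is in the tail of
  \<open>x\<close>'' is a forest. After further shrinking, the tail of \<open>x\<close> avoids all \<open>K\<^sub>i\<close> not containing
  \<open>x\<close>, and the downward closures of the \<open>K\<^sub>i\<close> in the forest are open and pairwise disjoint.\<close>

section \<open>Countable ordinals\<close>

text \<open>Otherwise countably many initial segments, each countable, would cover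
  \<open>omega1\<close>.\<close>

lemma countable_omega1_bounded:
  fixes S :: "omega1 set"
  assumes "countable S"
  obtains \<delta> where "S \<subseteq> {..<\<delta>}"
proof -
  have "\<exists>\<delta>. \<forall>s\<in>S. s < \<delta>"
  proof (rule ccontr)
    assume "\<nexists>\<delta>. \<forall>s\<in>S. s < \<delta>"
    then have "\<exists>s\<in>S. \<delta> \<le> s" for \<delta>
      by (meson not_le)
    then have "UNIV = (\<Union>s\<in>S. insert s {..<s})"
      by (auto simp: le_less)
    then have "countable (UNIV :: omega1 set)"
      using assms countable_lessThan_omega1 by (metis countable_UN countable_insert)
    then show False
      using uncountable_UNIV_omega1 by blast
  qed
  then show thesis
    using that by auto
qed

lemma omega1_no_top: "\<exists>\<beta>. \<alpha> < (\<beta> :: omega1)"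
  using countable_omega1_bounded[of "{\<alpha>}"] by auto

lemma acc_omega1_unbounded: "\<exists>\<alpha>\<in>acc_omega1. \<delta> < \<alpha>"
proof -
  obtain s :: "omega1 \<Rightarrow> omega1" where s: "\<And>x. x < s x"
    using omega1_no_top by metis
  define f where "f n = (s ^^ n) \<delta>" for n
  have f: "f n < f (Suc n)" for n
    by (simp add: f_def s)
  obtain \<beta> where "range f \<subseteq> {..<\<beta>}"
    using countable_omega1_bounded[of "range f"] by auto
  then have "\<forall>n. f n < \<beta>"
    by auto
  \<comment> \<open>The least strict upper bound of the strictly increasing \<open>f\<close> is a
    limit: anything below it is at most some \<open>f n\<close>, hence below
    \<open>f (Suc n)\<close>.\<close>
  define \<alpha> where "\<alpha> = (LEAST \<beta>. \<forall>n. f n < \<beta>)"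
  have lt: "f n < \<alpha>" for n
    using LeastI[of "\<lambda>\<beta>. \<forall>n. f n < \<beta>", OF \<open>\<forall>n. f n < \<beta>\<close>] unfolding \<alpha>_def by blast
  have "\<exists>\<gamma><\<alpha>. \<xi> < \<gamma>" if "\<xi> < \<alpha>" for \<xi>
  proof -
    have "\<not> (\<forall>n. f n < \<xi>)"
      using that unfolding \<alpha>_def by (rule not_less_Least)
    then obtain n where "\<xi> \<le> f n"
      by (meson not_le)
    then show ?thesis
      using f[of n] lt[of "Suc n"] by (meson order.strict_trans1)
  qed
  moreover have "\<delta> < \<alpha>"
    using lt[of 0] by (simp add: f_def)
  ultimately show ?thesis
    unfolding acc_omega1_def by blast
qed

lemma acc_omega1_between: "\<alpha> \<in> acc_omega1 \<Longrightarrow> \<beta> < \<alpha> \<Longrightarrow> \<exists>\<gamma><\<alpha>. \<beta> < \<gamma>"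
  unfolding acc_omega1_def by blast

section \<open>The limit part of a countable ordinal\<close>

definition limpart :: "omega1 \<Rightarrow> omega1" where
  "limpart x = (LEAST \<mu>. \<forall>z\<in>acc_omega1. z \<le> x \<longrightarrow> z \<le> \<mu>)"

lemma limpart_le: "limpart x \<le> x"
  unfolding limpart_def by (rule Least_le) blast

lemma limpart_upper: "z \<in> acc_omega1 \<Longrightarrow> z \<le> x \<Longrightarrow> z \<le> limpart x"
  using LeastI[of "\<lambda>\<mu>. \<forall>z\<in>acc_omega1. z \<le> x \<longrightarrow> z \<le> \<mu>" x] unfolding limpart_def by blast

text \<open>A supremum of limits that were not itself a limit would have an immediate predecessor,
  and that predecessor would already bound those limits.\<close>

lemma limpart_in_acc_omega1:
  assumes "z \<in> acc_omega1" "z \<le> x"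
  shows "limpart x \<in> acc_omega1"
proof (rule ccontr)
  assume no: "limpart x \<notin> acc_omega1"
  have "z < limpart x"
    using limpart_upper[OF assms] no assms(1) by (metis le_less)
  then have "\<exists>\<nu><limpart x. \<forall>\<gamma><limpart x. \<not> \<nu> < \<gamma>"
    using no unfolding acc_omega1_def by blast
  then obtain \<nu> where \<nu>: "\<nu> < limpart x" "\<And>\<gamma>. \<gamma> < limpart x \<Longrightarrow> \<gamma> \<le> \<nu>"
    by (auto simp: not_less)
  have "\<forall>z\<in>acc_omega1. z \<le> x \<longrightarrow> z \<le> \<nu>"
    using limpart_upper no \<nu>(2) by (metis le_less)
  then have "limpart x \<le> \<nu>"
    unfolding limpart_def by (rule Least_le)
  with \<nu>(1) show False
    by simp
qed

text \<open>Any limit above \<delta> serves as \<epsilon>. This makes the fibres of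
  \<open>limpart\<close> countable and later provides ladders with a tail above \<delta>.\<close>

lemma limpart_eventually_greater: "\<exists>\<epsilon>>\<delta>. \<forall>x\<ge>\<epsilon>. \<delta> < limpart x"
  using acc_omega1_unbounded limpart_upper by (meson order.strict_trans2)

lemma countable_limpart_fibre: "countable {x. limpart x = \<alpha>}"
proof -
  obtain \<epsilon> where "\<forall>x\<ge>\<epsilon>. \<alpha> < limpart x"
    using limpart_eventually_greater by blast
  then have "{x. limpart x = \<alpha>} \<subseteq> {..<\<epsilon>}"
    by (auto simp flip: not_le)
  then show ?thesis
    using countable_lessThan_omega1 countable_subset by blast
qed

text \<open>The empty set has to be allowed separately because of \<open>\<alpha> = 0\<close>, the value of \<open>limpart\<close> at finite
  ordinals.\<close>

definition bounded_in :: "omega1 \<Rightarrow> omega1 set \<Rightarrow> bool" where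
  "bounded_in \<alpha> S \<longleftrightarrow> S = {} \<or> (\<exists>\<beta><\<alpha>. S \<subseteq> {..<\<beta>})"

lemma bounded_in_empty [simp]: "bounded_in \<alpha> {}"
  by (simp add: bounded_in_def)

lemma bounded_in_subset: "bounded_in \<alpha> T \<Longrightarrow> S \<subseteq> T \<Longrightarrow> bounded_in \<alpha> S"
  unfolding bounded_in_def by blast

lemma bounded_in_Un:
  assumes "bounded_in \<alpha> S" "bounded_in \<alpha> T"
  shows "bounded_in \<alpha> (S \<union> T)"
proof (cases "S = {} \<or> T = {}")
  case True
  then show ?thesis
    using assms by auto
next
  case False
  then obtain \<beta> \<gamma> where "\<beta> < \<alpha>" "S \<subseteq> {..<\<beta>}" "\<gamma> < \<alpha>" "T \<subseteq> {..<\<gamma>}"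
    using assms unfolding bounded_in_def by auto
  then have "max \<beta> \<gamma> < \<alpha>" "S \<union> T \<subseteq> {..<max \<beta> \<gamma>}"
    by (auto simp: less_max_iff_disj)
  then show ?thesis
    unfolding bounded_in_def by blast
qed

lemma bounded_in_UN:
  assumes "finite I" "\<And>i. i \<in> I \<Longrightarrow> bounded_in \<alpha> (S i)"
  shows "bounded_in \<alpha> (\<Union>i\<in>I. S i)"
  using assms by (induction I) (auto intro: bounded_in_Un)

lemma bounded_in_acc_omega1:
  "\<alpha> \<in> acc_omega1 \<Longrightarrow> bounded_in \<alpha> S \<longleftrightarrow> (\<exists>\<beta><\<alpha>. S \<subseteq> {..<\<beta>})"
  unfolding bounded_in_def acc_omega1_def by blast

section \<open>Suprema and bounded sets\<close>

lemma osup_cofinal_subset: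
  assumes "\<alpha> \<in> acc_omega1" "cofinal_subset A \<alpha>"
  shows "osup A = Fin \<alpha>"
proof -
  have ub: "\<forall>\<gamma>\<in>A. \<gamma> \<le> \<alpha>"
    using assms(2) by (force simp: cofinal_subset_def)
  have "\<alpha> \<le> \<beta>" if "\<forall>\<gamma>\<in>A. \<gamma> \<le> \<beta>" for \<beta>
  proof (rule ccontr)
    assume "\<not> \<alpha> \<le> \<beta>"
    then obtain \<gamma> where "\<beta> < \<gamma>" "\<gamma> < \<alpha>"
      using acc_omega1_between[OF assms(1)] by (meson not_le)
    then obtain \<xi> where "\<xi> \<in> A" "\<gamma> \<le> \<xi>"
      using assms(2) unfolding cofinal_subset_def by blast
    with that \<open>\<beta> < \<gamma>\<close> show False
      by (meson leD order.trans)
  qed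
  then have "(LEAST \<beta>. \<forall>\<gamma>\<in>A. \<gamma> \<le> \<beta>) = \<alpha>"
    using ub by (intro Least_equality)
  moreover have "bdd_above A"
    using ub by (auto simp: bdd_above_def)
  ultimately show ?thesis
    by (simp add: osup_def)
qed

lemma osup_le_Fin:
  assumes "S \<subseteq> {..\<beta>}"
  shows "osup S \<le> Fin \<beta>"
proof -
  have ub: "\<forall>\<gamma>\<in>S. \<gamma> \<le> \<beta>"
    using assms by auto
  then have "bdd_above S" "(LEAST \<beta>. \<forall>\<gamma>\<in>S. \<gamma> \<le> \<beta>) \<le> \<beta>"
    by (auto simp: bdd_above_def intro: Least_le)
  then show ?thesis
    by (simp add: osup_def)
qed

text \<open>Turns the suprema of the ladder system into the ideal of bounded sets. Since \<alpha> is
  a limit, a supremum below \<alpha>, even if attained, leaves room for a strict bound below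
  \<alpha>.\<close>

lemma osup_less_iff_bounded_in:
  assumes "\<alpha> \<in> acc_omega1"
  shows "osup S < Fin \<alpha> \<longleftrightarrow> bounded_in \<alpha> S"
proof
  assume less: "osup S < Fin \<alpha>"
  define \<beta> where "\<beta> = (LEAST \<beta>. \<forall>\<gamma>\<in>S. \<gamma> \<le> \<beta>)"
  have bdd: "bdd_above S" and "\<beta> < \<alpha>"
    using less by (auto simp: osup_def \<beta>_def split: if_splits)
  from bdd obtain \<xi> where "\<forall>\<gamma>\<in>S. \<gamma> \<le> \<xi>"
    by (auto simp: bdd_above_def)
  then have "\<forall>\<gamma>\<in>S. \<gamma> \<le> \<beta>"
    unfolding \<beta>_def by (rule LeastI)
  moreover obtain \<gamma> where "\<beta> < \<gamma>" "\<gamma> < \<alpha>"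
    using acc_omega1_between[OF assms \<open>\<beta> < \<alpha>\<close>] by blast
  ultimately have "S \<subseteq> {..<\<gamma>}"
    by (auto intro: order.strict_trans1)
  then show "bounded_in \<alpha> S"
    using \<open>\<gamma> < \<alpha>\<close> unfolding bounded_in_def by blast
next
  assume "bounded_in \<alpha> S"
  then obtain \<beta> where "\<beta> < \<alpha>" "S \<subseteq> {..<\<beta>}"
    using assms bounded_in_acc_omega1 by blast
  then have "osup S \<le> Fin \<beta>" "Fin \<beta> < Fin \<alpha>"
    by (auto intro!: osup_le_Fin)
  then show "osup S < Fin \<alpha>"
    by (rule order.strict_trans1)
qed

section \<open>Discrete families\<close>

lemma discrete_family_disjoint:
  assumes "discrete_family X I K" "i \<in> I" "j \<in> I" "x \<in> K i" "x \<in> K j" "x \<in> topspace X"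
  shows "i = j"
proof -
  obtain N where "x \<in> N"
      "\<And>i j. i \<in> I \<Longrightarrow> j \<in> I \<Longrightarrow> N \<inter> K i \<noteq> {} \<Longrightarrow> N \<inter> K j \<noteq> {} \<Longrightarrow> i = j"
    using assms(1,6) unfolding discrete_family_def by meson
  then show ?thesis
    using assms(2-5) by blast
qed

lemma discrete_family_subset:
  assumes "discrete_family X I K" "J \<subseteq> I" "\<And>i. i \<in> J \<Longrightarrow> K' i \<subseteq> K i"
  shows "discrete_family X J K'"
  unfolding discrete_family_def
proof
  fix x assume "x \<in> topspace X"
  then obtain N where N: "openin X N" "x \<in> N"
      "\<And>i j. i \<in> I \<Longrightarrow> j \<in> I \<Longrightarrow> N \<inter> K i \<noteq> {} \<Longrightarrow> N \<inter> K j \<noteq> {} \<Longrightarrow> i = j"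
    using assms(1) unfolding discrete_family_def by meson
  have "i = j" if "i \<in> J" "j \<in> J" "N \<inter> K' i \<noteq> {}" "N \<inter> K' j \<noteq> {}" for i j
    by (rule N(3)) (use that assms(2) assms(3)[of i] assms(3)[of j] in blast)+
  with N(1,2) show "\<exists>N. openin X N \<and> x \<in> N \<and>
      (\<forall>i\<in>J. \<forall>j\<in>J. N \<inter> K' i \<noteq> {} \<and> N \<inter> K' j \<noteq> {} \<longrightarrow> i = j)"
    by blast
qed

text \<open>A neighbourhood of an outside point that meets at most one member misses the whole union
  once that closed member is removed.\<close>

lemma closedin_UN_discrete_family:
  assumes closed: "\<And>i. i \<in> I \<Longrightarrow> closedin X (K i)" and "discrete_family X I K"
  shows "closedin X (\<Union>i\<in>I. K i)"
  unfolding closedin_def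
proof
  show "(\<Union>i\<in>I. K i) \<subseteq> topspace X"
    using closedin_subset[OF closed] by (rule UN_least)
  show "openin X (topspace X - (\<Union>i\<in>I. K i))"
  proof (subst openin_subopen, intro ballI)
    fix x assume x: "x \<in> topspace X - (\<Union>i\<in>I. K i)"
    then have "x \<in> topspace X"
      by blast
    then obtain N where N: "openin X N" "x \<in> N"
        "\<And>i j. i \<in> I \<Longrightarrow> j \<in> I \<Longrightarrow> N \<inter> K i \<noteq> {} \<Longrightarrow> N \<inter> K j \<noteq> {} \<Longrightarrow> i = j"
      using assms(2) unfolding discrete_family_def by meson
    show "\<exists>T. openin X T \<and> x \<in> T \<and> T \<subseteq> topspace X - (\<Union>i\<in>I. K i)"
    proof (cases "\<exists>i\<in>I. N \<inter> K i \<noteq> {}")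
      case True
      then obtain i where i: "i \<in> I" "N \<inter> K i \<noteq> {}"
        by blast
      have "y \<notin> K j" if "y \<in> N - K i" "j \<in> I" for y j
        using N(3)[OF i(1) that(2) i(2)] that(1) by blast
      then have "N - K i \<subseteq> topspace X - (\<Union>i\<in>I. K i)"
        using openin_subset[OF N(1)] by blast
      moreover have "openin X (N - K i)"
        using N(1) closed[OF i(1)] by (rule openin_diff)
      ultimately show ?thesis
        using x N(2) i(1) by blast
    next
      case False
      then have "N \<subseteq> topspace X - (\<Union>i\<in>I. K i)"
        using openin_subset[OF N(1)] by blast
      then show ?thesis
        using N(1,2) by blast
    qed
  qed
qed

text \<open>Two disjoint closed sets form a discrete family indexed by \<open>bool\<close>.
  Normality will yield regularity and the Hausdorff property from \<open>t1_space\<close>.\<close>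

lemma collectionwise_normal_imp_normal_space:
  assumes "collectionwise_normal X"
  shows "normal_space X"
  unfolding normal_space_def
proof (intro allI impI)
  fix S T assume ST: "closedin X S \<and> closedin X T \<and> disjnt S T"
  define K where "K b = (if b then S else T)" for b
  have "discrete_family X UNIV K"
    unfolding discrete_family_def
  proof
    fix x assume x: "x \<in> topspace X"
    show "\<exists>N. openin X N \<and> x \<in> N \<and>
        (\<forall>i\<in>UNIV. \<forall>j\<in>UNIV. N \<inter> K i \<noteq> {} \<and> N \<inter> K j \<noteq> {} \<longrightarrow> i = j)"
    proof (cases "x \<in> S")
      case True
      then have "openin X (topspace X - T)" "x \<in> topspace X - T"
        using ST x by (auto simp: disjnt_def)
      then show ?thesis
        by (intro exI[of _ "topspace X - T"]) (auto simp: K_def)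
    next
      case False
      then have "openin X (topspace X - S)" "x \<in> topspace X - S"
        using ST x by auto
      then show ?thesis
        by (intro exI[of _ "topspace X - S"]) (auto simp: K_def)
    qed
  qed
  moreover have "closedin X (K b)" for b
    using ST by (simp add: K_def)
  ultimately have "\<exists>U. (\<forall>b\<in>UNIV. openin X (U b) \<and> K b \<subseteq> U b) \<and> disjoint_family_on U UNIV"
    using assms by (intro collectionwise_normal_any_index)
  then obtain U where U: "\<And>b. openin X (U b) \<and> K b \<subseteq> U b" "disjoint_family_on U UNIV"
    by blast
  have "S \<subseteq> U True" "T \<subseteq> U False"
    using U(1)[of True] U(1)[of False] by (simp_all add: K_def)
  moreover have "disjnt (U True) (U False)"
    using disjoint_family_onD[OF U(2), of True False] by (simp add: disjnt_def)
  ultimately show "\<exists>U V. openin X U \<and> openin X V \<and> S \<subseteq> U \<and> T \<subseteq> V \<and> disjnt U V"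
    using U(1) by blast
qed

section \<open>The space of a ladder system\<close>

text \<open>What the topology uses of the principle: a ladder for every point, not only for every
  limit. Points below the first limit get the empty ladder and become isolated.\<close>

locale guessing_ladders =
  fixes L :: "omega1 \<Rightarrow> omega1 set"
  assumes cofinal: "limpart x \<in> acc_omega1 \<Longrightarrow> cofinal_subset (L x) (limpart x)"
    and empty: "limpart x \<notin> acc_omega1 \<Longrightarrow> L x = {}"
    and almost_disjoint: "x \<noteq> y \<Longrightarrow> bounded_in (limpart x) (L x \<inter> L y)"
    and guess: "uncountable B \<Longrightarrow>
      \<exists>\<alpha>\<in>acc_omega1. \<forall>x. limpart x = \<alpha> \<longrightarrow> \<not> bounded_in \<alpha> (L x \<inter> B)"
begin

lemma ladder_less_limpart: "y \<in> L x \<Longrightarrow> y < limpart x"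
  using cofinal[of x] empty[of x] unfolding cofinal_subset_def by auto

lemma ladder_less: "y \<in> L x \<Longrightarrow> y < x"
  using ladder_less_limpart limpart_le order.strict_trans2 by blast

lemma bounded_in_ladder_atMost:
  assumes "\<beta> < limpart x"
  shows "bounded_in (limpart x) (L x \<inter> {..\<beta>})"
proof (cases "limpart x \<in> acc_omega1")
  case True
  then obtain \<gamma> where "\<gamma> < limpart x" "\<beta> < \<gamma>"
    using acc_omega1_between assms by blast
  then have "L x \<inter> {..\<beta>} \<subseteq> {..<\<gamma>}"
    by auto
  then show ?thesis
    using \<open>\<gamma> < limpart x\<close> unfolding bounded_in_def by blast
qed (simp add: empty)

lemma unbounded_ladder_atLeast:
  assumes "limpart x \<in> acc_omega1" "\<beta> < limpart x"
  shows "\<not> bounded_in (limpart x) (L x \<inter> {\<beta>..})"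
proof
  assume "bounded_in (limpart x) (L x \<inter> {\<beta>..})"
  then obtain \<gamma> where \<gamma>: "\<gamma> < limpart x" "L x \<inter> {\<beta>..} \<subseteq> {..<\<gamma>}"
    using assms(1) bounded_in_acc_omega1 by blast
  have "max \<beta> \<gamma> < limpart x"
    using assms(2) \<gamma>(1) by simp
  then obtain \<xi> where "\<xi> \<in> L x" "max \<beta> \<gamma> \<le> \<xi>"
    using cofinal[OF assms(1)] unfolding cofinal_subset_def by blast
  with \<gamma>(2) show False
    by fastforce
qed

section \<open>The topology, its open and its closed sets\<close>

definition ladder_topology :: "omega1 topology" where
  "ladder_topology = topology (\<lambda>U. \<forall>x\<in>U. bounded_in (limpart x) (L x - U))"

lemma openin_ladder_topology:
  "openin ladder_topology U \<longleftrightarrow> (\<forall>x\<in>U. bounded_in (limpart x) (L x - U))"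
proof -
  have "istopology (\<lambda>U. \<forall>x\<in>U. bounded_in (limpart x) (L x - U))"
    unfolding istopology_def
  proof (intro conjI allI impI ballI)
    fix S T x
    assume "\<forall>x\<in>S. bounded_in (limpart x) (L x - S)" "\<forall>x\<in>T. bounded_in (limpart x) (L x - T)"
      "x \<in> S \<inter> T"
    then show "bounded_in (limpart x) (L x - S \<inter> T)"
      by (simp add: Diff_Int bounded_in_Un)
  next
    fix \<K> x
    assume "\<forall>S\<in>\<K>. \<forall>x\<in>S. bounded_in (limpart x) (L x - S)" "x \<in> \<Union>\<K>"
    then show "bounded_in (limpart x) (L x - \<Union>\<K>)"
      by (blast intro: bounded_in_subset)
  qed
  then show ?thesis
    by (simp add: ladder_topology_def topology_inverse')
qed

lemma topspace_ladder_topology [simp]: "topspace ladder_topology = UNIV"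
proof -
  have "openin ladder_topology UNIV"
    by (simp add: openin_ladder_topology)
  then show ?thesis
    using openin_subset by blast
qed

lemma closedin_ladder_topology:
  "closedin ladder_topology F \<longleftrightarrow> (\<forall>x. x \<notin> F \<longrightarrow> bounded_in (limpart x) (L x \<inter> F))"
  by (auto simp: closedin_def openin_ladder_topology Diff_eq)

lemma t1_space_ladder_topology: "t1_space ladder_topology"
  unfolding t1_space_closedin_singleton
proof
  fix y assume "y \<in> topspace ladder_topology"
  have "bounded_in (limpart x) (L x \<inter> {y})" for x
  proof (cases "y \<in> L x")
    case True
    then show ?thesis
      by (intro bounded_in_subset[OF bounded_in_ladder_atMost[OF ladder_less_limpart]]) auto
  qed auto
  then show "closedin ladder_topology {y}"
    by (simp add: closedin_ladder_topology)
qed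

section \<open>Uncountable closed sets and open covers\<close>

lemma uncountable_closedin_ladder_topology:
  assumes closed: "closedin ladder_topology F" and "uncountable F"
  obtains \<alpha> where "{\<alpha>..} \<subseteq> F"
proof -
  obtain \<alpha> where \<alpha>: "\<alpha> \<in> acc_omega1" "\<And>x. limpart x = \<alpha> \<Longrightarrow> \<not> bounded_in \<alpha> (L x \<inter> F)"
    using guess[OF assms(2)] by blast
  have "x \<in> F" if "\<alpha> \<le> x" for x
    using that
  proof (induction x rule: less_induct)
    case (less x)
    have acc: "limpart x \<in> acc_omega1"
      using limpart_in_acc_omega1[OF \<alpha>(1) less.prems] .
    have "\<not> bounded_in (limpart x) (L x \<inter> F)"
    proof (cases "limpart x = \<alpha>")
      case True
      then show ?thesis
        using \<alpha>(2) by blast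
    next
      case False
      then have "\<alpha> < limpart x"
        using limpart_upper[OF \<alpha>(1) less.prems] by simp
      \<comment> \<open>Ladder elements lie below \<open>x\<close>, so the induction hypothesis puts
        all those from \<alpha> on into \<open>F\<close>; they are unbounded in
        \<open>limpart x\<close>.\<close>
      moreover have "L x \<inter> {\<alpha>..} \<subseteq> L x \<inter> F"
        using less.IH ladder_less by auto
      ultimately show ?thesis
        using unbounded_ladder_atLeast[OF acc] bounded_in_subset by blast
    qed
    then show ?case
      using closed closedin_ladder_topology by blast
  qed
  then show thesis
    using that by auto
qed

text \<open>An uncountable closed complement would contain a final segment and so confine
  \<open>U\<close> to a countable initial segment.\<close>

lemma countable_Compl_uncountable_open:
  assumes "openin ladder_topology U" "uncountable U"
  shows "countable (- U)"
proof (rule ccontr)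
  assume "uncountable (- U)"
  moreover have "closedin ladder_topology (- U)"
    using assms(1) openin_closedin_eq[of ladder_topology U] by (simp add: Compl_eq_Diff_UNIV)
  ultimately obtain \<alpha> where "{\<alpha>..} \<subseteq> - U"
    using uncountable_closedin_ladder_topology by blast
  then have "U \<subseteq> {..<\<alpha>}"
    by (auto simp flip: not_le)
  then show False
    using assms(2) countable_lessThan_omega1 countable_subset by blast
qed

lemma not_Lindelof_ladder_topology: "\<not> Lindelof_space ladder_topology"
proof
  assume "Lindelof_space ladder_topology"
  \<comment> \<open>Ladders descend, so a point of an initial segment has its whole ladder inside
    it.\<close>
  moreover have "openin ladder_topology {..<\<alpha>}" for \<alpha>
  proof -
    have "L x - {..<\<alpha>} = {}" if "x < \<alpha>" for x
      using that ladder_less[of _ x] by fastforce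
    then show ?thesis
      unfolding openin_ladder_topology by (metis bounded_in_empty lessThan_iff)
  qed
  moreover have "\<Union>(range lessThan) = (UNIV :: omega1 set)"
    using omega1_no_top by auto
  ultimately obtain \<V> where \<V>: "countable \<V>" "\<V> \<subseteq> range lessThan" "\<Union>\<V> = (UNIV :: omega1 set)"
    unfolding Lindelof_space_def topspace_ladder_topology by (metis (no_types, lifting) imageE)
  then have "countable V" if "V \<in> \<V>" for V
    using that countable_lessThan_omega1 by blast
  then have "countable (\<Union>\<V>)"
    using countable_UN[OF \<V>(1), of "\<lambda>V. V"] by simp
  then show False
    using \<V>(3) uncountable_UNIV_omega1 by simp
qed

section \<open>Separation of discrete families\<close>

lemma discrete_family_ladder_topology:
  assumes closed: "\<And>i. i \<in> I \<Longrightarrow> closedin ladder_topology (K i)"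
    and discrete: "discrete_family ladder_topology I K"
  shows "\<exists>\<delta>. \<forall>i\<in>I. K i \<subseteq> {..<\<delta>} \<or> {\<delta>..} \<subseteq> K i"
proof (cases "\<exists>i\<in>I. uncountable (K i)")
  case True
  then obtain i where "i \<in> I" "uncountable (K i)"
    by blast
  with closed obtain \<delta> where i: "i \<in> I" "{\<delta>..} \<subseteq> K i"
    using uncountable_closedin_ladder_topology[of "K i"] by blast
  \<comment> \<open>One member contains a final segment, and disjointness confines every other
    member below \<delta>.\<close>
  have "K j \<subseteq> {..<\<delta>} \<or> {\<delta>..} \<subseteq> K j" if "j \<in> I" for j
  proof (cases "i = j")
    case False
    then have "K i \<inter> K j = {}"
      using discrete_family_disjoint[OF discrete i(1) that] by auto
    then show ?thesis
      using i(2) by (force simp: not_le[symmetric] simp del: not_le)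
  qed (use i in simp)
  then show ?thesis
    by blast
next
  case False
  define J where "J = {i\<in>I. K i \<noteq> {}}"
  \<comment> \<open>All members are countable here, so it suffices that only countably many are
    nonempty; one point is picked from each of these.\<close>
  define p where "p i = (SOME x. x \<in> K i)" for i
  have p: "p i \<in> K i" if "i \<in> J" for i
    using that unfolding J_def p_def by (auto intro: someI_ex)
  have inj: "inj_on p J"
  proof (rule inj_onI)
    fix i j assume ij: "i \<in> J" "j \<in> J" "p i = p j"
    then have "p i \<in> K i" "p i \<in> K j"
      using p by metis+
    then show "i = j"
      using ij discrete_family_disjoint[OF discrete, of i j "p i"] by (simp add: J_def)
  qed
  have sub_closed: "closedin ladder_topology (p ` M)" if "M \<subseteq> J" for M
  proof -
    have "discrete_family ladder_topology M (\<lambda>i. {p i})"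
      using discrete by (rule discrete_family_subset) (use that p J_def in blast)+
    then have "closedin ladder_topology (\<Union>i\<in>M. {p i})"
      using t1_space_ladder_topology
      by (intro closedin_UN_discrete_family) (auto simp: t1_space_closedin_singleton)
    then show ?thesis
      by (simp only: UNION_singleton_eq_range)
  qed
  have "countable (p ` J)"
  proof (rule ccontr)
    assume "uncountable (p ` J)"
    then obtain \<alpha> where \<alpha>: "{\<alpha>..} \<subseteq> p ` J"
      by (rule uncountable_closedin_ladder_topology[OF sub_closed[OF subset_refl]])
    \<comment> \<open>Removing a limit \<open>x\<close> from the picked points leaves a closed set
      that misses \<open>x\<close> but contains the ladder of \<open>x\<close> from \<alpha> on,
      which is unbounded.\<close>
    obtain x where x: "x \<in> acc_omega1" "\<alpha> < x"
      using acc_omega1_unbounded by blast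
    then have lim: "limpart x = x"
      using limpart_upper[OF x(1), of x] limpart_le[of x] by simp
    have "p ` J - {x} = p ` {i \<in> J. p i \<noteq> x}"
      by auto
    then have "closedin ladder_topology (p ` J - {x})"
      using sub_closed[of "{i \<in> J. p i \<noteq> x}"] by (simp only: Collect_subset)
    then have "bounded_in x (L x \<inter> (p ` J - {x}))"
      using lim unfolding closedin_ladder_topology by (metis DiffD2 singletonI)
    moreover have "L x \<inter> {\<alpha>..} \<subseteq> L x \<inter> (p ` J - {x})"
      using \<alpha> ladder_less[of x x] by blast
    ultimately have "bounded_in x (L x \<inter> {\<alpha>..})"
      by (rule bounded_in_subset)
    then show False
      using unbounded_ladder_atLeast[of x \<alpha>] x lim by simp
  qed
  then have "countable J"
    using inj by (rule countable_image_inj_on)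
  then have "countable (\<Union>i\<in>J. K i)"
    using False by (intro countable_UN) (auto simp: J_def)
  then obtain \<delta> where "(\<Union>i\<in>J. K i) \<subseteq> {..<\<delta>}"
    by (rule countable_omega1_bounded)
  then have "K i \<subseteq> {..<\<delta>} \<or> {\<delta>..} \<subseteq> K i" if "i \<in> I" for i
    using that unfolding J_def by blast
  then show ?thesis
    by blast
qed

text \<open>In an enumeration of \<open>E\<close> each point has finitely many predecessors;
  removing their ladders costs only a bounded set, by almost disjointness.\<close>

lemma disjoint_tails:
  assumes "countable E"
  obtains T where "\<And>x. x \<in> E \<Longrightarrow> T x \<subseteq> L x" "\<And>x. x \<in> E \<Longrightarrow> bounded_in (limpart x) (L x - T x)"
    "disjoint_family_on T E"
proof -
  define P where "P x = {y\<in>E. to_nat_on E y < to_nat_on E x}" for x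
  define T where "T x = L x - (\<Union>y\<in>P x. L y)" for x
  have inj: "inj_on (to_nat_on E) E"
    using assms by (rule inj_on_to_nat_on)
  have "bounded_in (limpart x) (L x - T x)" if "x \<in> E" for x
  proof -
    have "finite (to_nat_on E ` P x)"
      by (rule finite_subset[of _ "{..<to_nat_on E x}"]) (auto simp: P_def)
    moreover have "inj_on (to_nat_on E) (P x)"
      using inj by (rule inj_on_subset) (auto simp: P_def)
    ultimately have "finite (P x)"
      by (rule finite_imageD)
    then have "bounded_in (limpart x) (\<Union>y\<in>P x. L x \<inter> L y)"
      by (rule bounded_in_UN) (auto simp: P_def intro: almost_disjoint)
    then show ?thesis
      by (rule bounded_in_subset) (auto simp: T_def)
  qed
  moreover have "disjoint_family_on T E"
    unfolding disjoint_family_on_def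
  proof (intro ballI impI)
    fix x y assume xy: "x \<in> E" "y \<in> E" "x \<noteq> y"
    then have "to_nat_on E x \<noteq> to_nat_on E y"
      using inj by (meson inj_onD)
    then have "x \<in> P y \<or> y \<in> P x"
      using xy by (auto simp: P_def)
    then show "T x \<inter> T y = {}"
      by (auto simp: T_def)
  qed
  ultimately show thesis
    using that[of T] by (auto simp: T_def)
qed

lemma separation_below:
  assumes closed: "\<And>i. i \<in> I \<Longrightarrow> closedin ladder_topology (K i)"
    and discrete: "discrete_family ladder_topology I K"
  shows "\<exists>U. (\<forall>i\<in>I. openin ladder_topology (U i) \<and> K i \<inter> {..<\<epsilon>} \<subseteq> U i \<and> U i \<subseteq> {..<\<epsilon>}) \<and>
    disjoint_family_on U I"
proof -
  obtain T where T: "\<And>x. x < \<epsilon> \<Longrightarrow> T x \<subseteq> L x"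
      "\<And>x. x < \<epsilon> \<Longrightarrow> bounded_in (limpart x) (L x - T x)" "disjoint_family_on T {..<\<epsilon>}"
    using disjoint_tails[OF countable_lessThan_omega1[of \<epsilon>]] unfolding lessThan_iff by blast
  \<comment> \<open>\<open>D x\<close> collects the members that avoid \<open>x\<close>.
    Discreteness makes it closed, so the ladder of \<open>x\<close> meets it in a bounded
    set.\<close>
  define D where "D x = (\<Union>i\<in>{i\<in>I. x \<notin> K i}. K i)" for x
  have D: "bounded_in (limpart x) (L x \<inter> D x)" for x
  proof -
    have "closedin ladder_topology (D x)"
      unfolding D_def using discrete closed
      by (intro closedin_UN_discrete_family) (auto intro: discrete_family_subset)
    moreover have "x \<notin> D x"
      by (auto simp: D_def)
    ultimately show ?thesis
      using closedin_ladder_topology by blast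
  qed
  \<comment> \<open>Edges lead from a tail element \<open>y\<close> up to \<open>x\<close>. Leaving
    out \<open>D x\<close> ensures that an edge starting in some \<open>K i\<close> also ends in
    \<open>K i\<close>.\<close>
  define R where "R = {(y, x). x < \<epsilon> \<and> y \<in> T x - D x}"
  define U where "U i = {y. \<exists>x\<in>K i \<inter> {..<\<epsilon>}. (y, x) \<in> R\<^sup>*}" for i
  have below: "y < \<epsilon>" if "(y, x) \<in> R\<^sup>*" "x < \<epsilon>" for x y
    using that
  proof (induction rule: converse_rtrancl_induct)
    case (step y z)
    then show ?case
      using T(1)[of z] ladder_less[of y z] by (auto simp: R_def)
  qed
  have "openin ladder_topology (U i)" for i
    unfolding openin_ladder_topology
  proof
    fix y assume y: "y \<in> U i"
    then have "y < \<epsilon>"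
      using below by (auto simp: U_def)
    \<comment> \<open>Each such tail element extends the chain of \<open>y\<close> by one edge at
      the lower end.\<close>
    then have "T y - D y \<subseteq> U i"
      using y by (auto simp: U_def R_def intro: converse_rtrancl_into_rtrancl)
    moreover have "bounded_in (limpart y) ((L y - T y) \<union> (L y \<inter> D y))"
      using T(2)[OF \<open>y < \<epsilon>\<close>] D by (rule bounded_in_Un)
    ultimately show "bounded_in (limpart y) (L y - U i)"
      by (elim bounded_in_subset) blast
  qed
  moreover have "disjoint_family_on U I"
    unfolding disjoint_family_on_def
  proof (intro ballI impI, rule ccontr)
    fix i j assume ij: "i \<in> I" "j \<in> I" "i \<noteq> j" "U i \<inter> U j \<noteq> {}"
    have up: "x \<in> K i" if "(y, x) \<in> R\<^sup>*" "y \<in> K i" "i \<in> I" for x y i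
      using that by (induction rule: rtrancl_induct) (auto simp: R_def D_def)
    from ij(4) obtain y u v where yuv: "u \<in> K i" "(y, u) \<in> R\<^sup>*" "v \<in> K j" "(y, v) \<in> R\<^sup>*"
      by (auto simp: U_def)
    \<comment> \<open>Disjoint tails give each point at most one upward edge, so two chains from
      \<open>y\<close> are comparable: one of \<open>u\<close>, \<open>v\<close> is reached from the
      other and therefore lies in both members.\<close>
    have "single_valued R"
      using T(3) unfolding R_def single_valued_def disjoint_family_on_def by blast
    then have "(u, v) \<in> R\<^sup>* \<or> (v, u) \<in> R\<^sup>*"
      using yuv by (intro single_valued_confluent)
    then have "\<exists>w. w \<in> K i \<and> w \<in> K j"
      using up yuv ij by blast
    then show False
      using discrete_family_disjoint[OF discrete] ij by auto
  qed
  moreover have "K i \<inter> {..<\<epsilon>} \<subseteq> U i" "U i \<subseteq> {..<\<epsilon>}" for i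
    using below by (auto simp: U_def)
  ultimately show ?thesis
    by blast
qed

lemma collectionwise_normal_ladder_topology: "collectionwise_normal ladder_topology"
  unfolding collectionwise_normal_def
proof (intro allI impI, elim conjE)
  fix I K assume closed: "\<forall>i\<in>I. closedin ladder_topology (K i)"
    and discrete: "discrete_family ladder_topology I K"
  obtain \<delta> where \<delta>: "\<And>i. i \<in> I \<Longrightarrow> K i \<subseteq> {..<\<delta>} \<or> {\<delta>..} \<subseteq> K i"
    using discrete_family_ladder_topology[OF bspec[OF closed] discrete] by blast
  \<comment> \<open>Ladders of points from \<epsilon> on have a tail above \<delta>; the points
    between \<delta> and \<epsilon> are left to the separation below \<epsilon>.\<close>
  obtain \<epsilon> where \<epsilon>: "\<delta> < \<epsilon>" "\<And>x. \<epsilon> \<le> x \<Longrightarrow> \<delta> < limpart x"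
    using limpart_eventually_greater by blast
  obtain U where U: "\<And>i. i \<in> I \<Longrightarrow> openin ladder_topology (U i)"
    "\<And>i. i \<in> I \<Longrightarrow> K i \<inter> {..<\<epsilon>} \<subseteq> U i" "\<And>i. i \<in> I \<Longrightarrow> U i \<subseteq> {..<\<epsilon>}" "disjoint_family_on U I"
    using separation_below[OF bspec[OF closed] discrete, of \<epsilon>] by blast
  define V where "V i = (if {\<delta>..} \<subseteq> K i then U i \<union> {\<delta>..} else U i)" for i
  have "openin ladder_topology (V i) \<and> K i \<subseteq> V i" if "i \<in> I" for i
  proof (cases "{\<delta>..} \<subseteq> K i")
    case True
    have "bounded_in (limpart x) (L x - (U i \<union> {\<delta>..}))" if x: "x \<in> U i \<union> {\<delta>..}" for x
    proof (cases "\<epsilon> \<le> x")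
      case True
      then have "bounded_in (limpart x) (L x \<inter> {..\<delta>})"
        using \<epsilon>(2) by (intro bounded_in_ladder_atMost)
      then show ?thesis
        by (rule bounded_in_subset) auto
    next
      case False
      \<comment> \<open>Here \<open>x\<close> is below \<epsilon>; if it comes from the added
        segment, it lies in \<open>K i\<close> and hence already in \<open>U i\<close>.\<close>
      then have "x \<in> U i"
        using x U(2)[OF \<open>i \<in> I\<close>] \<open>{\<delta>..} \<subseteq> K i\<close> by auto
      then have "bounded_in (limpart x) (L x - U i)"
        using U(1)[OF \<open>i \<in> I\<close>] openin_ladder_topology by blast
      then show ?thesis
        by (rule bounded_in_subset) auto
    qed
    then have "openin ladder_topology (U i \<union> {\<delta>..})"
      by (simp add: openin_ladder_topology)
    moreover have "K i \<subseteq> U i \<union> {\<delta>..}"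
      using U(2)[OF that] \<epsilon>(1) by fastforce
    ultimately show ?thesis
      using True by (simp add: V_def)
  next
    case False
    then have "K i \<subseteq> {..<\<delta>}"
      using \<delta>[OF that] by blast
    then have "K i \<subseteq> K i \<inter> {..<\<epsilon>}"
      using \<epsilon>(1) by (auto intro: order.strict_trans)
    then have "K i \<subseteq> U i"
      using U(2)[OF that] by (rule subset_trans)
    then show ?thesis
      using False U(1)[OF that] by (simp add: V_def)
  qed
  moreover have "disjoint_family_on V I"
  proof -
    have "x \<notin> V j" if "i \<in> I" "j \<in> I" "i \<noteq> j" "{\<delta>..} \<subseteq> K i" "\<delta> \<le> x" for i j x
    proof -
      have "\<not> {\<delta>..} \<subseteq> K j"
        using discrete_family_disjoint[OF discrete that(1,2), of \<delta>] that(3,4) by auto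
      \<comment> \<open>A point of \<open>U j\<close> from \<delta> on would be below \<epsilon> and
        in \<open>K i\<close>, hence also in the disjoint set \<open>U i\<close>.\<close>
      moreover have "x \<notin> U j"
        using U(2)[OF that(1)] U(3)[OF that(2)] disjoint_family_onD[OF U(4) that(1-3)] that(4,5)
        by (metis IntI atLeast_iff empty_iff subsetD)
      ultimately show ?thesis
        by (simp add: V_def)
    qed
    then have "\<not> (x \<in> V i \<and> x \<in> V j)" if "i \<in> I" "j \<in> I" "i \<noteq> j" for i j x
      using that disjoint_family_onD[OF U(4) that] unfolding V_def
      by (smt (verit) Un_iff atLeast_iff disjoint_iff)
    then show ?thesis
      unfolding disjoint_family_on_def by blast
  qed
  ultimately show "\<exists>U. (\<forall>i\<in>I. openin ladder_topology (U i) \<and> K i \<subseteq> U i) \<and> disjoint_family_on U I"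
    by blast
qed

lemma O_space_ladder_topology: "O_space ladder_topology"
proof -
  have "normal_space ladder_topology"
    using collectionwise_normal_ladder_topology by (rule collectionwise_normal_imp_normal_space)
  then have "Hausdorff_space ladder_topology" "regular_space ladder_topology"
    using t1_space_ladder_topology normal_t1_imp_Hausdorff_space normal_t1_imp_regular_space by auto
  then show ?thesis
    using t1_space_ladder_topology uncountable_UNIV_omega1 countable_Compl_uncountable_open
    by (simp add: O_space_def Compl_eq_Diff_UNIV)
qed

end

section \<open>Ladders from the guessing principle\<close>

lemma guessing_ladders_exist:
  assumes "clubsuit_AD_omega1_omega_1"
  shows "\<exists>L. guessing_ladders L"
proof -
  obtain \<A> where AD: "AD_multi_ladder_system UNIV \<A>"
    and card: "\<And>\<alpha>. \<A> \<alpha> \<approx> (UNIV :: nat set)"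
    and guess: "\<And>B. uncountable B \<Longrightarrow>
      stationary_omega1 {\<alpha>. \<forall>A\<in>\<A> \<alpha>. osup (A \<inter> B) = Fin \<alpha>}"
    using assms unfolding clubsuit_AD_omega1_omega_1_def by blast
  have "\<exists>g. bij_betw g (UNIV :: nat set) (\<A> \<alpha>)" for \<alpha>
    using card[of \<alpha>] eqpoll_sym unfolding eqpoll_def by (metis bij_betw_inv)
  then obtain g where g: "\<And>\<alpha>. bij_betw (g \<alpha>) (UNIV :: nat set) (\<A> \<alpha>)"
    by metis
  \<comment> \<open>Points with the same limit part form a countable block; their numbers under
    \<open>to_nat_on\<close> are distinct and select distinct ladders through the bijection
    \<open>g\<close>.\<close>
  define L where "L x = (if limpart x \<in> acc_omega1
      then g (limpart x) (to_nat_on {y. limpart y = limpart x} x) else {})" for x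
  have L: "L x \<in> \<A> (limpart x)" if "limpart x \<in> acc_omega1" for x
    using that bij_betwE[OF g] by (simp add: L_def)
  have cofinal: "cofinal_subset (L x) (limpart x)" if "limpart x \<in> acc_omega1" for x
    using AD L[OF that] that unfolding AD_multi_ladder_system_def by blast
  have osup: "osup (L x) = Fin (limpart x)" if "limpart x \<in> acc_omega1" for x
    using osup_cofinal_subset[OF that cofinal[OF that]] .
  have distinct: "L x \<noteq> L y" if "x \<noteq> y" "limpart x \<in> acc_omega1" "limpart y \<in> acc_omega1" for x y
  proof (cases "limpart x = limpart y")
    case True
    have "to_nat_on {z. limpart z = limpart y} x \<noteq> to_nat_on {z. limpart z = limpart y} y"
      using inj_on_to_nat_on[OF countable_limpart_fibre] True that(1) by (auto dest: inj_onD)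
    then show ?thesis
      using bij_betw_imp_inj_on[OF g[of "limpart y"]] True that by (auto simp: L_def dest: injD)
  next
    case False
    \<comment> \<open>Ladders at different limits have different suprema.\<close>
    then show ?thesis
      using osup[of x] osup[of y] that by auto
  qed
  have "guessing_ladders L"
  proof
    fix x y :: omega1
    assume xy: "x \<noteq> y"
    show "bounded_in (limpart x) (L x \<inter> L y)"
    proof (cases "limpart x \<in> acc_omega1 \<and> limpart y \<in> acc_omega1")
      case True
      then have "osup (L x \<inter> L y) < osup (L x)"
        using AD L distinct[OF xy] unfolding AD_multi_ladder_system_def by blast
      then show ?thesis
        using True osup osup_less_iff_bounded_in by simp
    qed (auto simp: L_def)
  next
    fix B :: "omega1 set" assume "uncountable B"
    \<comment> \<open>The stationary set of guessing ordinals must meet the club of limits, so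
      \<alpha> can be taken to be a limit.\<close>
    moreover have "club_omega1 acc_omega1"
      using acc_omega1_unbounded by (simp add: club_omega1_def)
    ultimately obtain \<alpha> where \<alpha>: "\<alpha> \<in> acc_omega1" "\<And>A. A \<in> \<A> \<alpha> \<Longrightarrow> osup (A \<inter> B) = Fin \<alpha>"
      using guess unfolding stationary_omega1_def by blast
    have "\<not> bounded_in \<alpha> (L x \<inter> B)" if "limpart x = \<alpha>" for x
      using \<alpha> L[of x] that osup_less_iff_bounded_in[OF \<alpha>(1), of "L x \<inter> B"] by auto
    then show "\<exists>\<alpha>\<in>acc_omega1. \<forall>x. limpart x = \<alpha> \<longrightarrow> \<not> bounded_in \<alpha> (L x \<inter> B)"
      using \<alpha>(1) by blast
  qed (use cofinal in \<open>auto simp: L_def\<close>)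
  then show ?thesis
    by blast
qed

theorem theorem4p4:
  assumes "clubsuit_AD_omega1_omega_1"
  shows "\<exists>X :: omega1 topology. O_space X \<and> collectionwise_normal X \<and> \<not> Lindelof_space X"
proof -
  obtain L where "guessing_ladders L"
    using guessing_ladders_exist[OF assms] by blast
  then interpret guessing_ladders L .
  show ?thesis
    using O_space_ladder_topology collectionwise_normal_ladder_topology not_Lindelof_ladder_topology
    by blast
qed

end
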